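(* Let $H$ be a non-coassociative bimonoid in $\mathsf{C}$. The following assertions are equivalent: (i) There exists a left codivision $l_H$ for $H$ such that $l_H=(\lambda_H\otimes H)\circ\delta_H$ holds for $\lambda_H=(H\otimes\varepsilon_H)\circ l_H$. (ii) There exists a left codivision $l_H$ for $H$ such that $(\mu_H\otimes H)\circ(\lambda_H\otimes\delta_H)\circ\delta_H=\eta_H\otimes H$ holds for $\lambda_H=(H\otimes\varepsilon_H)\circ l_H$. (iii) The non-coassociative bimonoid $H$ is a left Hopf coquasigroup.
   Context: $\mathsf{C}$ is a strict symmetric monoidal category with tensor product $\otimes$, unit object $K$ and symmetry $c$. For an object $P$ and a morphism $f$, write $P\otimes f$ for $\mathrm{id}_P\otimes f$ and $f\otimes P$ for $f\otimes \mathrm{id}_P$. A counital comagma is a triple $(D,\varepsilon_D,\delta_D)$ with $\varepsilon_D:D\to K$, $\delta_D:D\to D\otimes D$ such that $(\varepsilon_D\otimes D)\circ\delta_D=\mathrm{id}_D=(D\otimes\varepsilon_D)\circ\delta_D$ (no coassociativity required). A non-coassociative bimonoid is an object $H$ with a monoid structure $(H,\eta_H,\mu_H)$ (unital and associative) and a counital comagma structure $(H,\varepsilon_H,\delta_H)$ such that $\varepsilon_H\circ\eta_H=\mathrm{id}_K$, $\delta_H\circ\eta_H=\eta_H\otimes\eta_H$, $\varepsilon_H\circ\mu_H=\varepsilon_H\otimes\varepsilon_H$, and $\delta_H\circ\mu_H=(\mu_H\otimes\mu_H)\circ(H\otimes c_{H,H}\otimes H)\circ(\delta_H\otimes\delta_H)$.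 A left codivision of $H$ is a morphism $l_H:H\to H\otimes H$ such that $\gamma_L\circ l_H=\eta_H\otimes H=(\mu_H\otimes H)\circ(H\otimes l_H)\circ\delta_H$, where $\gamma_L=(\mu_H\otimes H)\circ(H\otimes\delta_H)$. A left Hopf coquasigroup is a non-coassociative bimonoid $H$ for which there exists a morphism $\lambda_H:H\to H$ (the left antipode) such that $$(\mu_H\otimes H)\circ(\lambda_H\otimes\delta_H)\circ\delta_H=\eta_H\otimes H=(\mu_H\otimes H)\circ(H\otimes((\lambda_H\otimes H)\circ\delta_H))\circ\delta_H.$$ *)

theory Defs
  imports Main
begin

record ('o, 'm) smc =
  Obj :: "'o set"
  Arr :: "'m set"
  Dom :: "'m \<Rightarrow> 'o"
  Cod :: "'m \<Rightarrow> 'o"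
  Idn :: "'o \<Rightarrow> 'm"
  Comp :: "'m \<Rightarrow> 'm \<Rightarrow> 'm"  (infixr "\<cdot>\<index>" 65)
  TObj :: "'o \<Rightarrow> 'o \<Rightarrow> 'o"  (infixr "\<odot>\<index>" 70)
  TArr :: "'m \<Rightarrow> 'm \<Rightarrow> 'm"  (infixr "\<otimes>\<index>" 70)
  Unit :: "'o"  ("\<K>\<index>")
  Symm :: "'o \<Rightarrow> 'o \<Rightarrow> 'm"

definition Hom :: "('o, 'm, 'x) smc_scheme \<Rightarrow> 'o \<Rightarrow> 'o \<Rightarrow> 'm set"
  where "Hom C A B = {f \<in> Arr C. Dom C f = A \<and> Cod C f = B}"

text \<open>The whiskerings \<open>P \<triangleright> f\<close> and \<open>f \<triangleleft> P\<close> are what is usually written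
  \<open>P \<otimes> f\<close> and \<open>f \<otimes> P\<close>.\<close>

abbreviation lwhisker :: "('o, 'm, 'x) smc_scheme \<Rightarrow> 'o \<Rightarrow> 'm \<Rightarrow> 'm"
    (infixr "\<triangleright>\<index>" 70)
  where "P \<triangleright>\<^bsub>C\<^esub> f \<equiv> Idn C P \<otimes>\<^bsub>C\<^esub> f"

abbreviation rwhisker :: "('o, 'm, 'x) smc_scheme \<Rightarrow> 'm \<Rightarrow> 'o \<Rightarrow> 'm"
    (infixl "\<triangleleft>\<index>" 75)
  where "f \<triangleleft>\<^bsub>C\<^esub> P \<equiv> f \<otimes>\<^bsub>C\<^esub> Idn C P"

text \<open>\<open>g \<cdot> f\<close> is \<open>g\<close> after \<open>f\<close>, and is
  only constrained when \<open>Dom C g = Cod C f\<close>. The second hexagon identity and the unit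
  condition \<open>Symm C A \<K> = Idn C A\<close> follow from the axioms for the symmetry below.\<close>

locale strict_symmetric_monoidal_category =
  fixes C :: "('o, 'm, 'x) smc_scheme" (structure)
  assumes Dom_Obj: "f \<in> Arr C \<Longrightarrow> Dom C f \<in> Obj C"
    and Cod_Obj: "f \<in> Arr C \<Longrightarrow> Cod C f \<in> Obj C"
    and Idn_Hom: "A \<in> Obj C \<Longrightarrow> Idn C A \<in> Hom C A A"
    and Comp_Hom: "\<lbrakk>f \<in> Hom C A B; g \<in> Hom C B D\<rbrakk> \<Longrightarrow> g \<cdot> f \<in> Hom C A D"
    and Comp_Idn: "f \<in> Hom C A B \<Longrightarrow> f \<cdot> Idn C A = f"
    and Idn_Comp: "f \<in> Hom C A B \<Longrightarrow> Idn C B \<cdot> f = f"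
    and Comp_assoc: "\<lbrakk>f \<in> Hom C A B; g \<in> Hom C B D; h \<in> Hom C D E\<rbrakk>
          \<Longrightarrow> (h \<cdot> g) \<cdot> f = h \<cdot> (g \<cdot> f)"
    and TObj_Obj: "\<lbrakk>A \<in> Obj C; B \<in> Obj C\<rbrakk> \<Longrightarrow> A \<odot> B \<in> Obj C"
    and Unit_Obj: "\<K> \<in> Obj C"
    and TArr_Hom: "\<lbrakk>f \<in> Hom C A B; g \<in> Hom C A' B'\<rbrakk> \<Longrightarrow> f \<otimes> g \<in> Hom C (A \<odot> A') (B \<odot> B')"
    and TArr_Idn: "\<lbrakk>A \<in> Obj C; B \<in> Obj C\<rbrakk> \<Longrightarrow> Idn C A \<otimes> Idn C B = Idn C (A \<odot> B)"
    and TArr_Comp: "\<lbrakk>f \<in> Hom C A B; g \<in> Hom C B D; f' \<in> Hom C A' B'; g' \<in> Hom C B' D'\<rbrakk>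
          \<Longrightarrow> (g \<cdot> f) \<otimes> (g' \<cdot> f') = (g \<otimes> g') \<cdot> (f \<otimes> f')"
    and TObj_assoc: "\<lbrakk>A \<in> Obj C; B \<in> Obj C; D \<in> Obj C\<rbrakk> \<Longrightarrow> (A \<odot> B) \<odot> D = A \<odot> (B \<odot> D)"
    and TArr_assoc: "\<lbrakk>f \<in> Arr C; g \<in> Arr C; h \<in> Arr C\<rbrakk> \<Longrightarrow> (f \<otimes> g) \<otimes> h = f \<otimes> (g \<otimes> h)"
    and Unit_TObj: "A \<in> Obj C \<Longrightarrow> \<K> \<odot> A = A"
    and TObj_Unit: "A \<in> Obj C \<Longrightarrow> A \<odot> \<K> = A"
    and Unit_TArr: "f \<in> Arr C \<Longrightarrow> \<K> \<triangleright> f = f"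
    and TArr_Unit: "f \<in> Arr C \<Longrightarrow> f \<triangleleft> \<K> = f"
    and Symm_Hom: "\<lbrakk>A \<in> Obj C; B \<in> Obj C\<rbrakk> \<Longrightarrow> Symm C A B \<in> Hom C (A \<odot> B) (B \<odot> A)"
    and Symm_natural: "\<lbrakk>f \<in> Hom C A B; g \<in> Hom C A' B'\<rbrakk>
          \<Longrightarrow> Symm C B B' \<cdot> (f \<otimes> g) = (g \<otimes> f) \<cdot> Symm C A A'"
    and Symm_Symm: "\<lbrakk>A \<in> Obj C; B \<in> Obj C\<rbrakk> \<Longrightarrow> Symm C B A \<cdot> Symm C A B = Idn C (A \<odot> B)"
    and Symm_hexagon: "\<lbrakk>A \<in> Obj C; B \<in> Obj C; D \<in> Obj C\<rbrakk>
          \<Longrightarrow> Symm C A (B \<odot> D) = (B \<triangleright> Symm C A D) \<cdot> (Symm C A B \<triangleleft> D)"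

definition monoid_in :: "('o, 'm, 'x) smc_scheme \<Rightarrow> 'o \<Rightarrow> 'm \<Rightarrow> 'm \<Rightarrow> bool"
  where "monoid_in C H \<eta> \<mu> \<longleftrightarrow>
    H \<in> Obj C \<and> \<eta> \<in> Hom C \<K>\<^bsub>C\<^esub> H \<and> \<mu> \<in> Hom C (H \<odot>\<^bsub>C\<^esub> H) H \<and>
    \<mu> \<cdot>\<^bsub>C\<^esub> (\<eta> \<triangleleft>\<^bsub>C\<^esub> H) = Idn C H \<and>
    \<mu> \<cdot>\<^bsub>C\<^esub> (H \<triangleright>\<^bsub>C\<^esub> \<eta>) = Idn C H \<and>
    \<mu> \<cdot>\<^bsub>C\<^esub> (\<mu> \<triangleleft>\<^bsub>C\<^esub> H) = \<mu> \<cdot>\<^bsub>C\<^esub> (H \<triangleright>\<^bsub>C\<^esub> \<mu>)"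

definition counital_comagma :: "('o, 'm, 'x) smc_scheme \<Rightarrow> 'o \<Rightarrow> 'm \<Rightarrow> 'm \<Rightarrow> bool"
  where "counital_comagma C D \<epsilon> \<delta> \<longleftrightarrow>
    D \<in> Obj C \<and> \<epsilon> \<in> Hom C D \<K>\<^bsub>C\<^esub> \<and> \<delta> \<in> Hom C D (D \<odot>\<^bsub>C\<^esub> D) \<and>
    (\<epsilon> \<triangleleft>\<^bsub>C\<^esub> D) \<cdot>\<^bsub>C\<^esub> \<delta> = Idn C D \<and>
    (D \<triangleright>\<^bsub>C\<^esub> \<epsilon>) \<cdot>\<^bsub>C\<^esub> \<delta> = Idn C D"

definition noncoassociative_bimonoid ::
    "('o, 'm, 'x) smc_scheme \<Rightarrow> 'o \<Rightarrow> 'm \<Rightarrow> 'm \<Rightarrow> 'm \<Rightarrow> 'm \<Rightarrow> bool"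
  where "noncoassociative_bimonoid C H \<eta> \<mu> \<epsilon> \<delta> \<longleftrightarrow>
    monoid_in C H \<eta> \<mu> \<and> counital_comagma C H \<epsilon> \<delta> \<and>
    \<epsilon> \<cdot>\<^bsub>C\<^esub> \<eta> = Idn C \<K>\<^bsub>C\<^esub> \<and>
    \<delta> \<cdot>\<^bsub>C\<^esub> \<eta> = \<eta> \<otimes>\<^bsub>C\<^esub> \<eta> \<and>
    \<epsilon> \<cdot>\<^bsub>C\<^esub> \<mu> = \<epsilon> \<otimes>\<^bsub>C\<^esub> \<epsilon> \<and>
    \<delta> \<cdot>\<^bsub>C\<^esub> \<mu> = (\<mu> \<otimes>\<^bsub>C\<^esub> \<mu>) \<cdot>\<^bsub>C\<^esub> (H \<triangleright>\<^bsub>C\<^esub> (Symm C H H \<triangleleft>\<^bsub>C\<^esub> H)) \<cdot>\<^bsub>C\<^esub> (\<delta> \<otimes>\<^bsub>C\<^esub> \<delta>)"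

definition gamma_L :: "('o, 'm, 'x) smc_scheme \<Rightarrow> 'o \<Rightarrow> 'm \<Rightarrow> 'm \<Rightarrow> 'm"
  where "gamma_L C H \<mu> \<delta> = (\<mu> \<triangleleft>\<^bsub>C\<^esub> H) \<cdot>\<^bsub>C\<^esub> (H \<triangleright>\<^bsub>C\<^esub> \<delta>)"

definition left_codivision ::
    "('o, 'm, 'x) smc_scheme \<Rightarrow> 'o \<Rightarrow> 'm \<Rightarrow> 'm \<Rightarrow> 'm \<Rightarrow> 'm \<Rightarrow> bool"
  where "left_codivision C H \<eta> \<mu> \<delta> l \<longleftrightarrow>
    l \<in> Hom C H (H \<odot>\<^bsub>C\<^esub> H) \<and>
    gamma_L C H \<mu> \<delta> \<cdot>\<^bsub>C\<^esub> l = \<eta> \<triangleleft>\<^bsub>C\<^esub> H \<and>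
    (\<mu> \<triangleleft>\<^bsub>C\<^esub> H) \<cdot>\<^bsub>C\<^esub> (H \<triangleright>\<^bsub>C\<^esub> l) \<cdot>\<^bsub>C\<^esub> \<delta> = \<eta> \<triangleleft>\<^bsub>C\<^esub> H"

definition left_antipode ::
    "('o, 'm, 'x) smc_scheme \<Rightarrow> 'o \<Rightarrow> 'm \<Rightarrow> 'm \<Rightarrow> 'm \<Rightarrow> 'm \<Rightarrow> bool"
  where "left_antipode C H \<eta> \<mu> \<delta> lam \<longleftrightarrow>
    lam \<in> Hom C H H \<and>
    (\<mu> \<triangleleft>\<^bsub>C\<^esub> H) \<cdot>\<^bsub>C\<^esub> (lam \<otimes>\<^bsub>C\<^esub> \<delta>) \<cdot>\<^bsub>C\<^esub> \<delta> = \<eta> \<triangleleft>\<^bsub>C\<^esub> H \<and>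
    (\<mu> \<triangleleft>\<^bsub>C\<^esub> H) \<cdot>\<^bsub>C\<^esub> (H \<triangleright>\<^bsub>C\<^esub> ((lam \<triangleleft>\<^bsub>C\<^esub> H) \<cdot>\<^bsub>C\<^esub> \<delta>)) \<cdot>\<^bsub>C\<^esub> \<delta> = \<eta> \<triangleleft>\<^bsub>C\<^esub> H"

definition left_Hopf_coquasigroup ::
    "('o, 'm, 'x) smc_scheme \<Rightarrow> 'o \<Rightarrow> 'm \<Rightarrow> 'm \<Rightarrow> 'm \<Rightarrow> 'm \<Rightarrow> bool"
  where "left_Hopf_coquasigroup C H \<eta> \<mu> \<epsilon> \<delta> \<longleftrightarrow>
    noncoassociative_bimonoid C H \<eta> \<mu> \<epsilon> \<delta> \<and> (\<exists>lam. left_antipode C H \<eta> \<mu> \<delta> lam)"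

end

theory Submission imports Defs
begin

text \<open>A monoid \<open>H\<close> makes \<open>H \<otimes> -\<close> a monad. A Kleisli arrow from \<open>X\<close> to \<open>Y\<close> is a morphism
  \<open>f : X \<rightarrow> H \<otimes> Y\<close>, it extends to the left \<open>H\<close>-linear map
  \<open>(\<mu> \<otimes> Y) \<circ> (H \<otimes> f) : H \<otimes> X \<rightarrow> H \<otimes> Y\<close>, and the Kleisli identity of \<open>X\<close> is \<open>\<eta> \<otimes> X\<close>.
  The linear extension of \<open>\<delta>\<close> is \<open>\<gamma>\<^sub>L\<close>, so the two equations for a left codivision \<open>l\<close> say
  exactly that \<open>l\<close> is a two-sided inverse of \<open>\<delta>\<close> in the Kleisli category. In particular
  a codivision is the only morphism \<open>m\<close> with \<open>\<gamma>\<^sub>L \<circ> m = \<eta> \<otimes> H\<close>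
  (lemma \<open>left_codivision_unique\<close>).

  Put \<open>m = (\<lambda> \<otimes> H) \<circ> \<delta>\<close>. By the interchange law the first antipode equation for \<open>\<lambda>\<close> is
  \<open>\<gamma>\<^sub>L \<circ> m = \<eta> \<otimes> H\<close>, and the second one is the second codivision equation for \<open>m\<close>.
  Hence \<open>\<lambda>\<close> is a left antipode if and only if \<open>m\<close> is a left codivision, and the counit
  recovers \<open>\<lambda>\<close> from \<open>m\<close> as \<open>(H \<otimes> \<epsilon>) \<circ> m\<close>; this identifies (i) with (iii). In (ii) the
  extra equation says \<open>\<gamma>\<^sub>L \<circ> m = \<eta> \<otimes> H\<close>, which by uniqueness of the codivision
  is the same as \<open>m = l\<close>, the extra equation of (i).\<close>

definition kleisli_ext :: "('o, 'm, 'x) smc_scheme \<Rightarrow> 'o \<Rightarrow> 'm \<Rightarrow> 'o \<Rightarrow> 'm \<Rightarrow> 'm"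
  where "kleisli_ext C H \<mu> Y f = (\<mu> \<triangleleft>\<^bsub>C\<^esub> Y) \<cdot>\<^bsub>C\<^esub> (H \<triangleright>\<^bsub>C\<^esub> f)"

lemma gamma_L_kleisli_ext: "gamma_L C H \<mu> \<delta> = kleisli_ext C H \<mu> H \<delta>"
  by (simp add: gamma_L_def kleisli_ext_def)

context strict_symmetric_monoidal_category
begin

section \<open>Whiskering\<close>

lemma Hom_Obj:
  assumes "f \<in> Hom C A B"
  shows "A \<in> Obj C" "B \<in> Obj C"
  using assms Dom_Obj Cod_Obj by (auto simp: Hom_def)

lemma Hom_Arr: "f \<in> Hom C A B \<Longrightarrow> f \<in> Arr C"
  by (simp add: Hom_def)

lemma lwhisker_Hom:
  "\<lbrakk>P \<in> Obj C; f \<in> Hom C A B\<rbrakk> \<Longrightarrow> P \<triangleright> f \<in> Hom C (P \<odot> A) (P \<odot> B)"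
  by (simp add: TArr_Hom Idn_Hom)

lemma rwhisker_Hom:
  "\<lbrakk>P \<in> Obj C; f \<in> Hom C A B\<rbrakk> \<Longrightarrow> f \<triangleleft> P \<in> Hom C (A \<odot> P) (B \<odot> P)"
  by (simp add: TArr_Hom Idn_Hom)

lemma lwhisker_Comp:
  assumes "P \<in> Obj C" "f \<in> Hom C A B" "g \<in> Hom C B D"
  shows "P \<triangleright> (g \<cdot> f) = (P \<triangleright> g) \<cdot> (P \<triangleright> f)"
  using TArr_Comp[OF Idn_Hom[OF assms(1)] Idn_Hom[OF assms(1)] assms(2,3)]
  by (simp add: Comp_Idn[OF Idn_Hom[OF assms(1)]])

lemma rwhisker_Comp:
  assumes "P \<in> Obj C" "f \<in> Hom C A B" "g \<in> Hom C B D"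
  shows "(g \<cdot> f) \<triangleleft> P = (g \<triangleleft> P) \<cdot> (f \<triangleleft> P)"
  using TArr_Comp[OF assms(2,3) Idn_Hom[OF assms(1)] Idn_Hom[OF assms(1)]]
  by (simp add: Comp_Idn[OF Idn_Hom[OF assms(1)]])

lemma TArr_eq_rwhisker_lwhisker:
  assumes "f \<in> Hom C A B" "g \<in> Hom C A' B'"
  shows "f \<otimes> g = (f \<triangleleft> B') \<cdot> (A \<triangleright> g)"
  using TArr_Comp[OF Idn_Hom assms(1) assms(2) Idn_Hom] Hom_Obj[OF assms(1)]
    Hom_Obj[OF assms(2)] Comp_Idn[OF assms(1)] Idn_Comp[OF assms(2)] by simp

lemma TArr_eq_lwhisker_rwhisker:
  assumes "f \<in> Hom C A B" "g \<in> Hom C A' B'"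
  shows "f \<otimes> g = (B \<triangleright> g) \<cdot> (f \<triangleleft> A')"
  using TArr_Comp[OF assms(1) Idn_Hom Idn_Hom assms(2)] Hom_Obj[OF assms(1)]
    Hom_Obj[OF assms(2)] Comp_Idn[OF assms(2)] Idn_Comp[OF assms(1)] by simp

section \<open>The Kleisli category of a monoid\<close>

lemma kleisli_ext_Hom:
  assumes "monoid_in C H \<eta> \<mu>" "f \<in> Hom C X (H \<odot> Y)" "Y \<in> Obj C"
  shows "kleisli_ext C H \<mu> Y f \<in> Hom C (H \<odot> X) (H \<odot> Y)"
proof -
  have H: "H \<in> Obj C" and \<mu>: "\<mu> \<in> Hom C (H \<odot> H) H"
    using assms(1) by (auto simp: monoid_in_def)
  have "H \<triangleright> f \<in> Hom C (H \<odot> X) ((H \<odot> H) \<odot> Y)"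
    using lwhisker_Hom[OF H assms(2)] by (simp add: TObj_assoc H assms(3))
  then show ?thesis
    unfolding kleisli_ext_def using Comp_Hom rwhisker_Hom[OF assms(3) \<mu>] by blast
qed

lemma kleisli_ext_unit:
  assumes "monoid_in C H \<eta> \<mu>" "X \<in> Obj C"
  shows "kleisli_ext C H \<mu> X (\<eta> \<triangleleft> X) = Idn C (H \<odot> X)"
proof -
  have H: "H \<in> Obj C" and \<eta>: "\<eta> \<in> Hom C \<K> H" and \<mu>: "\<mu> \<in> Hom C (H \<odot> H) H"
    and u: "\<mu> \<cdot> (H \<triangleright> \<eta>) = Idn C H"
    using assms(1) by (auto simp: monoid_in_def)
  have H\<eta>: "H \<triangleright> \<eta> \<in> Hom C H (H \<odot> H)"
    using lwhisker_Hom[OF H \<eta>] by (simp add: TObj_Unit H)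
  have "kleisli_ext C H \<mu> X (\<eta> \<triangleleft> X) = (\<mu> \<triangleleft> X) \<cdot> ((H \<triangleright> \<eta>) \<triangleleft> X)"
    unfolding kleisli_ext_def using TArr_assoc Hom_Arr \<eta> Idn_Hom H assms(2) by metis
  also have "\<dots> = (\<mu> \<cdot> (H \<triangleright> \<eta>)) \<triangleleft> X"
    using rwhisker_Comp[OF assms(2) H\<eta> \<mu>] by simp
  also have "\<dots> = Idn C (H \<odot> X)"
    by (simp add: u TArr_Idn H assms(2))
  finally show ?thesis .
qed

lemma kleisli_ext_comp_unit:
  assumes "monoid_in C H \<eta> \<mu>" "f \<in> Hom C X (H \<odot> Y)" "Y \<in> Obj C"
  shows "kleisli_ext C H \<mu> Y f \<cdot> (\<eta> \<triangleleft> X) = f"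
proof -
  have H: "H \<in> Obj C" and \<eta>: "\<eta> \<in> Hom C \<K> H" and \<mu>: "\<mu> \<in> Hom C (H \<odot> H) H"
    and u: "\<mu> \<cdot> (\<eta> \<triangleleft> H) = Idn C H"
    using assms(1) by (auto simp: monoid_in_def)
  have X: "X \<in> Obj C" and HY: "H \<odot> Y \<in> Obj C" using Hom_Obj[OF assms(2)] by auto
  have \<eta>X: "\<eta> \<triangleleft> X \<in> Hom C X (H \<odot> X)"
    using rwhisker_Hom[OF X \<eta>] by (simp add: Unit_TObj X)
  have Hf: "H \<triangleright> f \<in> Hom C (H \<odot> X) ((H \<odot> H) \<odot> Y)"
    using lwhisker_Hom[OF H assms(2)] by (simp add: TObj_assoc H assms(3))
  have \<eta>H: "\<eta> \<triangleleft> H \<in> Hom C H (H \<odot> H)"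
    using rwhisker_Hom[OF H \<eta>] by (simp add: Unit_TObj H)
  have \<eta>HY: "(\<eta> \<triangleleft> H) \<triangleleft> Y \<in> Hom C (H \<odot> Y) ((H \<odot> H) \<odot> Y)"
    by (rule rwhisker_Hom[OF assms(3) \<eta>H])
  \<comment> \<open>The naturality of \<open>\<eta> \<otimes> -\<close>; strictness absorbs the unit object.\<close>
  have slide: "(H \<triangleright> f) \<cdot> (\<eta> \<triangleleft> X) = ((\<eta> \<triangleleft> H) \<triangleleft> Y) \<cdot> f"
  proof -
    have "(H \<triangleright> f) \<cdot> (\<eta> \<triangleleft> X) = (\<eta> \<triangleleft> (H \<odot> Y)) \<cdot> (\<K> \<triangleright> f)"
      using TArr_eq_rwhisker_lwhisker[OF \<eta> assms(2)] TArr_eq_lwhisker_rwhisker[OF \<eta> assms(2)]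
      by simp
    also have "\<eta> \<triangleleft> (H \<odot> Y) = (\<eta> \<triangleleft> H) \<triangleleft> Y"
      using TArr_assoc[OF Hom_Arr[OF \<eta>] Hom_Arr[OF Idn_Hom[OF H]] Hom_Arr[OF Idn_Hom[OF assms(3)]]]
      by (simp add: TArr_Idn H assms(3))
    also have "\<K> \<triangleright> f = f" by (rule Unit_TArr[OF Hom_Arr[OF assms(2)]])
    finally show ?thesis .
  qed
  have "kleisli_ext C H \<mu> Y f \<cdot> (\<eta> \<triangleleft> X) = (\<mu> \<triangleleft> Y) \<cdot> ((H \<triangleright> f) \<cdot> (\<eta> \<triangleleft> X))"
    unfolding kleisli_ext_def by (rule Comp_assoc[OF \<eta>X Hf rwhisker_Hom[OF assms(3) \<mu>]])
  also have "\<dots> = ((\<mu> \<triangleleft> Y) \<cdot> ((\<eta> \<triangleleft> H) \<triangleleft> Y)) \<cdot> f"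
    unfolding slide by (rule Comp_assoc[OF assms(2) \<eta>HY rwhisker_Hom[OF assms(3) \<mu>], symmetric])
  also have "\<dots> = Idn C (H \<odot> Y) \<cdot> f"
    using rwhisker_Comp[OF assms(3) \<eta>H \<mu>] by (simp add: u TArr_Idn H assms(3))
  also have "\<dots> = f" by (rule Idn_Comp[OF assms(2)])
  finally show ?thesis .
qed

text \<open>The linear extension of \<open>f\<close> is a map of left \<open>H\<close>-modules: \<open>f\<close> slides past
  \<open>\<mu>\<close> by interchange, and the two multiplications are reordered by associativity.\<close>

lemma kleisli_ext_linear:
  assumes "monoid_in C H \<eta> \<mu>" "f \<in> Hom C X (H \<odot> Y)" "Y \<in> Obj C"
  shows "kleisli_ext C H \<mu> Y f \<cdot> (\<mu> \<triangleleft> X) = (\<mu> \<triangleleft> Y) \<cdot> (H \<triangleright> kleisli_ext C H \<mu> Y f)"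
proof -
  have H: "H \<in> Obj C" and \<mu>: "\<mu> \<in> Hom C (H \<odot> H) H"
    and a: "\<mu> \<cdot> (\<mu> \<triangleleft> H) = \<mu> \<cdot> (H \<triangleright> \<mu>)"
    using assms(1) by (auto simp: monoid_in_def)
  note Y = assms(3)
  have X: "X \<in> Obj C" using Hom_Obj[OF assms(2)] by auto
  have HH: "H \<odot> H \<in> Obj C" by (simp add: TObj_Obj H)
  note arr = Hom_Arr[OF Idn_Hom[OF H]] Hom_Arr[OF Idn_Hom[OF Y]] Hom_Arr[OF \<mu>] Hom_Arr[OF assms(2)]
  have \<mu>X: "\<mu> \<triangleleft> X \<in> Hom C ((H \<odot> H) \<odot> X) (H \<odot> X)" by (rule rwhisker_Hom[OF X \<mu>])
  have \<mu>Y: "\<mu> \<triangleleft> Y \<in> Hom C ((H \<odot> H) \<odot> Y) (H \<odot> Y)" by (rule rwhisker_Hom[OF Y \<mu>])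
  have Hf: "H \<triangleright> f \<in> Hom C (H \<odot> X) ((H \<odot> H) \<odot> Y)"
    using lwhisker_Hom[OF H assms(2)] by (simp add: TObj_assoc H Y)
  have HHf: "(H \<odot> H) \<triangleright> f \<in> Hom C ((H \<odot> H) \<odot> X) (((H \<odot> H) \<odot> H) \<odot> Y)"
    using lwhisker_Hom[OF HH assms(2)] by (simp add: TObj_assoc HH H Y TObj_Obj)
  have \<mu>H: "\<mu> \<triangleleft> H \<in> Hom C ((H \<odot> H) \<odot> H) (H \<odot> H)" by (rule rwhisker_Hom[OF H \<mu>])
  have H\<mu>: "H \<triangleright> \<mu> \<in> Hom C ((H \<odot> H) \<odot> H) (H \<odot> H)"
    using lwhisker_Hom[OF H \<mu>] by (simp add: TObj_assoc H)
  have H\<mu>Y: "H \<triangleright> (\<mu> \<triangleleft> Y) = (H \<triangleright> \<mu>) \<triangleleft> Y" by (simp add: TArr_assoc arr)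
  have HHf_eq: "H \<triangleright> (H \<triangleright> f) = (H \<odot> H) \<triangleright> f"
    using TArr_assoc[OF arr(1) arr(1) arr(4)] by (simp add: TArr_Idn H)
  have slide: "(H \<triangleright> f) \<cdot> (\<mu> \<triangleleft> X) = ((\<mu> \<triangleleft> H) \<triangleleft> Y) \<cdot> ((H \<odot> H) \<triangleright> f)"
  proof -
    have "(H \<triangleright> f) \<cdot> (\<mu> \<triangleleft> X) = (\<mu> \<triangleleft> (H \<odot> Y)) \<cdot> ((H \<odot> H) \<triangleright> f)"
      using TArr_eq_rwhisker_lwhisker[OF \<mu> assms(2)] TArr_eq_lwhisker_rwhisker[OF \<mu> assms(2)]
      by simp
    also have "\<mu> \<triangleleft> (H \<odot> Y) = (\<mu> \<triangleleft> H) \<triangleleft> Y"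
      using TArr_assoc[OF arr(3,1,2)] by (simp add: TArr_Idn H Y)
    finally show ?thesis .
  qed
  have "kleisli_ext C H \<mu> Y f \<cdot> (\<mu> \<triangleleft> X) = (\<mu> \<triangleleft> Y) \<cdot> ((\<mu> \<triangleleft> H) \<triangleleft> Y) \<cdot> ((H \<odot> H) \<triangleright> f)"
    unfolding kleisli_ext_def using Comp_assoc[OF \<mu>X Hf \<mu>Y] slide by simp
  also have "\<dots> = ((\<mu> \<triangleleft> Y) \<cdot> ((\<mu> \<triangleleft> H) \<triangleleft> Y)) \<cdot> ((H \<odot> H) \<triangleright> f)"
    by (rule Comp_assoc[OF HHf rwhisker_Hom[OF Y \<mu>H] \<mu>Y, symmetric])
  also have "(\<mu> \<triangleleft> Y) \<cdot> ((\<mu> \<triangleleft> H) \<triangleleft> Y) = (\<mu> \<triangleleft> Y) \<cdot> ((H \<triangleright> \<mu>) \<triangleleft> Y)"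
    using rwhisker_Comp[OF Y \<mu>H \<mu>] rwhisker_Comp[OF Y H\<mu> \<mu>] a by simp
  also have "((\<mu> \<triangleleft> Y) \<cdot> ((H \<triangleright> \<mu>) \<triangleleft> Y)) \<cdot> ((H \<odot> H) \<triangleright> f)
      = (\<mu> \<triangleleft> Y) \<cdot> ((H \<triangleright> \<mu>) \<triangleleft> Y) \<cdot> ((H \<odot> H) \<triangleright> f)"
    by (rule Comp_assoc[OF HHf rwhisker_Hom[OF Y H\<mu>] \<mu>Y])
  also have "\<dots> = (\<mu> \<triangleleft> Y) \<cdot> (H \<triangleright> kleisli_ext C H \<mu> Y f)"
    unfolding kleisli_ext_def using lwhisker_Comp[OF H Hf \<mu>Y] H\<mu>Y HHf_eq by simp
  finally show ?thesis .
qed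

text \<open>Associativity of Kleisli composition. The inner extension multiplies before \<open>f\<close> is
  applied, and linearity of the outer one moves that multiplication to the end.\<close>

lemma kleisli_ext_comp:
  assumes "monoid_in C H \<eta> \<mu>" "f \<in> Hom C Y (H \<odot> Z)" "Z \<in> Obj C" "g \<in> Hom C X (H \<odot> Y)"
  shows "kleisli_ext C H \<mu> Z f \<cdot> kleisli_ext C H \<mu> Y g
    = kleisli_ext C H \<mu> Z (kleisli_ext C H \<mu> Z f \<cdot> g)"
proof -
  let ?F = "kleisli_ext C H \<mu> Z f"
  have H: "H \<in> Obj C" and \<mu>: "\<mu> \<in> Hom C (H \<odot> H) H"
    using assms(1) by (auto simp: monoid_in_def)
  have Y: "Y \<in> Obj C" using Hom_Obj[OF assms(2)] by auto
  have Hg: "H \<triangleright> g \<in> Hom C (H \<odot> X) ((H \<odot> H) \<odot> Y)"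
    using lwhisker_Hom[OF H assms(4)] by (simp add: TObj_assoc H Y)
  have F: "?F \<in> Hom C (H \<odot> Y) (H \<odot> Z)" by (rule kleisli_ext_Hom[OF assms(1-3)])
  have HF: "H \<triangleright> ?F \<in> Hom C ((H \<odot> H) \<odot> Y) ((H \<odot> H) \<odot> Z)"
    using lwhisker_Hom[OF H F] by (simp add: TObj_assoc H Y assms(3))
  have "?F \<cdot> kleisli_ext C H \<mu> Y g = (?F \<cdot> (\<mu> \<triangleleft> Y)) \<cdot> (H \<triangleright> g)"
    unfolding kleisli_ext_def[of C H \<mu> Y g]
    by (rule Comp_assoc[OF Hg rwhisker_Hom[OF Y \<mu>] F, symmetric])
  also have "\<dots> = (\<mu> \<triangleleft> Z) \<cdot> (H \<triangleright> ?F) \<cdot> (H \<triangleright> g)"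
    unfolding kleisli_ext_linear[OF assms(1-3)]
    by (rule Comp_assoc[OF Hg HF rwhisker_Hom[OF assms(3) \<mu>]])
  also have "\<dots> = kleisli_ext C H \<mu> Z (?F \<cdot> g)"
    unfolding kleisli_ext_def[of C H \<mu> Z "?F \<cdot> g"] using lwhisker_Comp[OF H assms(4) F] by simp
  finally show ?thesis .
qed

text \<open>The usual argument that a left inverse and a right inverse agree, in the Kleisli category.\<close>

lemma kleisli_inverse_unique:
  assumes "monoid_in C H \<eta> \<mu>" "d \<in> Hom C X (H \<odot> Y)" "l \<in> Hom C Y (H \<odot> X)"
    and "m \<in> Hom C Y (H \<odot> X)" "X \<in> Obj C" "Y \<in> Obj C"
    and left: "kleisli_ext C H \<mu> X l \<cdot> d = \<eta> \<triangleleft> X"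
    and right: "kleisli_ext C H \<mu> Y d \<cdot> m = \<eta> \<triangleleft> Y"
  shows "m = l"
proof -
  let ?L = "kleisli_ext C H \<mu> X l" and ?D = "kleisli_ext C H \<mu> Y d"
  have L: "?L \<in> Hom C (H \<odot> Y) (H \<odot> X)" by (rule kleisli_ext_Hom[OF assms(1,3,5)])
  have D: "?D \<in> Hom C (H \<odot> X) (H \<odot> Y)" by (rule kleisli_ext_Hom[OF assms(1,2,6)])
  have "m = Idn C (H \<odot> X) \<cdot> m" by (rule Idn_Comp[OF assms(4), symmetric])
  also have "\<dots> = (?L \<cdot> ?D) \<cdot> m"
    using kleisli_ext_comp[OF assms(1,3,5,2)] left kleisli_ext_unit[OF assms(1,5)] by simp
  also have "\<dots> = ?L \<cdot> (?D \<cdot> m)" by (rule Comp_assoc[OF assms(4) D L])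
  also have "\<dots> = l" unfolding right by (rule kleisli_ext_comp_unit[OF assms(1,3,5)])
  finally show ?thesis .
qed

section \<open>Codivisions and antipodes\<close>

text \<open>A codivision is a two-sided Kleisli inverse of \<open>\<delta>\<close>, and the hypothesis on \<open>m\<close> makes
  \<open>m\<close> a one-sided inverse, so the two coincide.\<close>

lemma left_codivision_unique:
  assumes "monoid_in C H \<eta> \<mu>" "\<delta> \<in> Hom C H (H \<odot> H)"
    and "left_codivision C H \<eta> \<mu> \<delta> l"
    and "m \<in> Hom C H (H \<odot> H)" "gamma_L C H \<mu> \<delta> \<cdot> m = \<eta> \<triangleleft> H"
  shows "m = l"
proof -
  have H: "H \<in> Obj C" and \<mu>: "\<mu> \<in> Hom C (H \<odot> H) H"
    using assms(1) by (auto simp: monoid_in_def)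
  have l: "l \<in> Hom C H (H \<odot> H)" using assms(3) by (simp add: left_codivision_def)
  have Hl: "H \<triangleright> l \<in> Hom C (H \<odot> H) ((H \<odot> H) \<odot> H)"
    using lwhisker_Hom[OF H l] by (simp add: TObj_assoc H)
  have "kleisli_ext C H \<mu> H l \<cdot> \<delta> = \<eta> \<triangleleft> H"
    using assms(3) Comp_assoc[OF assms(2) Hl rwhisker_Hom[OF H \<mu>]]
    by (simp add: left_codivision_def kleisli_ext_def)
  moreover have "kleisli_ext C H \<mu> H \<delta> \<cdot> m = \<eta> \<triangleleft> H"
    using assms(5) by (simp add: gamma_L_kleisli_ext)
  ultimately show ?thesis by (rule kleisli_inverse_unique[OF assms(1,2) l assms(4) H H])
qed

text \<open>By interchange, \<open>\<lambda>\<close> and the second comultiplication act on different legs of \<open>\<delta>\<close>.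
  This reads the first antipode equation as the first codivision equation for
  \<open>(\<lambda> \<otimes> H) \<circ> \<delta>\<close>.\<close>

lemma gamma_L_comp_rwhisker:
  assumes "\<mu> \<in> Hom C (H \<odot> H) H" "\<delta> \<in> Hom C H (H \<odot> H)" "lam \<in> Hom C H H"
  shows "gamma_L C H \<mu> \<delta> \<cdot> ((lam \<triangleleft> H) \<cdot> \<delta>) = (\<mu> \<triangleleft> H) \<cdot> (lam \<otimes> \<delta>) \<cdot> \<delta>"
proof -
  have H: "H \<in> Obj C" using Hom_Obj[OF assms(3)] by auto
  have lH: "lam \<triangleleft> H \<in> Hom C (H \<odot> H) (H \<odot> H)" by (rule rwhisker_Hom[OF H assms(3)])
  have H\<delta>: "H \<triangleright> \<delta> \<in> Hom C (H \<odot> H) ((H \<odot> H) \<odot> H)"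
    using lwhisker_Hom[OF H assms(2)] by (simp add: TObj_assoc H)
  have "gamma_L C H \<mu> \<delta> \<cdot> ((lam \<triangleleft> H) \<cdot> \<delta>) = (\<mu> \<triangleleft> H) \<cdot> (H \<triangleright> \<delta>) \<cdot> (lam \<triangleleft> H) \<cdot> \<delta>"
    unfolding gamma_L_def
    by (rule Comp_assoc[OF Comp_Hom[OF assms(2) lH] H\<delta> rwhisker_Hom[OF H assms(1)]])
  also have "(H \<triangleright> \<delta>) \<cdot> (lam \<triangleleft> H) \<cdot> \<delta> = (lam \<otimes> \<delta>) \<cdot> \<delta>"
    unfolding TArr_eq_lwhisker_rwhisker[OF assms(3,2)]
    by (rule Comp_assoc[OF assms(2) lH H\<delta>, symmetric])
  finally show ?thesis .
qed

lemma left_antipode_iff_left_codivision: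
  assumes "\<mu> \<in> Hom C (H \<odot> H) H" "\<delta> \<in> Hom C H (H \<odot> H)" "lam \<in> Hom C H H"
  shows "left_antipode C H \<eta> \<mu> \<delta> lam \<longleftrightarrow> left_codivision C H \<eta> \<mu> \<delta> ((lam \<triangleleft> H) \<cdot> \<delta>)"
proof -
  have "(lam \<triangleleft> H) \<cdot> \<delta> \<in> Hom C H (H \<odot> H)"
    using Comp_Hom[OF assms(2) rwhisker_Hom[OF _ assms(3)]] Hom_Obj[OF assms(3)] by blast
  then show ?thesis
    using assms(3) gamma_L_comp_rwhisker[OF assms] by (simp add: left_antipode_def left_codivision_def)
qed

text \<open>The counit acts on the leg of \<open>\<delta>\<close> that \<open>\<lambda>\<close> does not touch, so interchange lets it cancel
  \<open>\<delta>\<close> first. Hence \<open>\<lambda> \<mapsto> (\<lambda> \<otimes> H) \<circ> \<delta>\<close> is injective.\<close>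

lemma counit_recovers_antipode:
  assumes "counital_comagma C H \<epsilon> \<delta>" "lam \<in> Hom C H H"
  shows "(H \<triangleright> \<epsilon>) \<cdot> ((lam \<triangleleft> H) \<cdot> \<delta>) = lam"
proof -
  have H: "H \<in> Obj C" and \<epsilon>: "\<epsilon> \<in> Hom C H \<K>" and \<delta>: "\<delta> \<in> Hom C H (H \<odot> H)"
    and u: "(H \<triangleright> \<epsilon>) \<cdot> \<delta> = Idn C H"
    using assms(1) by (auto simp: counital_comagma_def)
  have lH: "lam \<triangleleft> H \<in> Hom C (H \<odot> H) (H \<odot> H)" by (rule rwhisker_Hom[OF H assms(2)])
  have H\<epsilon>: "H \<triangleright> \<epsilon> \<in> Hom C (H \<odot> H) H"
    using lwhisker_Hom[OF H \<epsilon>] by (simp add: TObj_Unit H)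
  have "(H \<triangleright> \<epsilon>) \<cdot> ((lam \<triangleleft> H) \<cdot> \<delta>) = ((H \<triangleright> \<epsilon>) \<cdot> (lam \<triangleleft> H)) \<cdot> \<delta>"
    by (rule Comp_assoc[OF \<delta> lH H\<epsilon>, symmetric])
  also have "(H \<triangleright> \<epsilon>) \<cdot> (lam \<triangleleft> H) = (lam \<triangleleft> \<K>) \<cdot> (H \<triangleright> \<epsilon>)"
    using TArr_eq_rwhisker_lwhisker[OF assms(2) \<epsilon>] TArr_eq_lwhisker_rwhisker[OF assms(2) \<epsilon>]
    by simp
  also have "lam \<triangleleft> \<K> = lam" by (rule TArr_Unit[OF Hom_Arr[OF assms(2)]])
  also have "(lam \<cdot> (H \<triangleright> \<epsilon>)) \<cdot> \<delta> = lam \<cdot> (H \<triangleright> \<epsilon>) \<cdot> \<delta>"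
    by (rule Comp_assoc[OF \<delta> H\<epsilon> assms(2)])
  also have "\<dots> = lam" unfolding u by (rule Comp_Idn[OF assms(2)])
  finally show ?thesis .
qed

end

theorem theorem2p12:
  fixes C :: "('o, 'm, 'x) smc_scheme" (structure)
    and H :: 'o and \<eta> \<mu> \<epsilon> \<delta> :: 'm
  assumes "strict_symmetric_monoidal_category C"
    and "noncoassociative_bimonoid C H \<eta> \<mu> \<epsilon> \<delta>"
  shows "((\<exists>l. left_codivision C H \<eta> \<mu> \<delta> l \<and>
              (let lam = (H \<triangleright> \<epsilon>) \<cdot> l in l = (lam \<triangleleft> H) \<cdot> \<delta>)) \<longleftrightarrow>
          (\<exists>l. left_codivision C H \<eta> \<mu> \<delta> l \<and>
              (let lam = (H \<triangleright> \<epsilon>) \<cdot> l in (\<mu> \<triangleleft> H) \<cdot> (lam \<otimes> \<delta>) \<cdot> \<delta> = \<eta> \<triangleleft> H))) \<and>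
         ((\<exists>l. left_codivision C H \<eta> \<mu> \<delta> l \<and>
              (let lam = (H \<triangleright> \<epsilon>) \<cdot> l in (\<mu> \<triangleleft> H) \<cdot> (lam \<otimes> \<delta>) \<cdot> \<delta> = \<eta> \<triangleleft> H)) \<longleftrightarrow>
          left_Hopf_coquasigroup C H \<eta> \<mu> \<epsilon> \<delta>)"
proof -
  interpret strict_symmetric_monoidal_category C by (rule assms(1))
  have mon: "monoid_in C H \<eta> \<mu>" and com: "counital_comagma C H \<epsilon> \<delta>"
    using assms(2) by (auto simp: noncoassociative_bimonoid_def)
  have H: "H \<in> Obj C" and \<mu>: "\<mu> \<in> Hom C (H \<odot> H) H"
    using mon by (auto simp: monoid_in_def)
  have \<delta>: "\<delta> \<in> Hom C H (H \<odot> H)" and \<epsilon>: "\<epsilon> \<in> Hom C H \<K>"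
    using com by (auto simp: counital_comagma_def)
  have lam_Hom: "(H \<triangleright> \<epsilon>) \<cdot> l \<in> Hom C H H" if "left_codivision C H \<eta> \<mu> \<delta> l" for l
    using that Comp_Hom lwhisker_Hom[OF H \<epsilon>]
    by (auto simp: left_codivision_def TObj_Unit H)
  \<comment> \<open>Both conditions say that the morphism built from \<open>\<lambda>\<close> is the Kleisli inverse of \<open>\<delta>\<close>,
    so they agree for each \<open>l\<close> separately and no new codivision has to be constructed.\<close>
  have i_ii: "l = (((H \<triangleright> \<epsilon>) \<cdot> l) \<triangleleft> H) \<cdot> \<delta> \<longleftrightarrow>
      (\<mu> \<triangleleft> H) \<cdot> (((H \<triangleright> \<epsilon>) \<cdot> l) \<otimes> \<delta>) \<cdot> \<delta> = \<eta> \<triangleleft> H"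
    if l: "left_codivision C H \<eta> \<mu> \<delta> l" for l
  proof -
    let ?m = "(((H \<triangleright> \<epsilon>) \<cdot> l) \<triangleleft> H) \<cdot> \<delta>"
    have m: "?m \<in> Hom C H (H \<odot> H)" by (rule Comp_Hom[OF \<delta> rwhisker_Hom[OF H lam_Hom[OF l]]])
    have "l = ?m \<longleftrightarrow> gamma_L C H \<mu> \<delta> \<cdot> ?m = \<eta> \<triangleleft> H"
      using left_codivision_unique[OF mon \<delta> l m] l by (metis left_codivision_def)
    then show ?thesis using gamma_L_comp_rwhisker[OF \<mu> \<delta> lam_Hom[OF l]] by simp
  qed
  have i_iii: "(\<exists>l. left_codivision C H \<eta> \<mu> \<delta> l \<and> l = (((H \<triangleright> \<epsilon>) \<cdot> l) \<triangleleft> H) \<cdot> \<delta>) \<longleftrightarrow>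
      left_Hopf_coquasigroup C H \<eta> \<mu> \<epsilon> \<delta>"
  proof
    assume "\<exists>l. left_codivision C H \<eta> \<mu> \<delta> l \<and> l = (((H \<triangleright> \<epsilon>) \<cdot> l) \<triangleleft> H) \<cdot> \<delta>"
    then obtain l where l: "left_codivision C H \<eta> \<mu> \<delta> l"
      and eq: "l = (((H \<triangleright> \<epsilon>) \<cdot> l) \<triangleleft> H) \<cdot> \<delta>" by blast
    have "left_antipode C H \<eta> \<mu> \<delta> ((H \<triangleright> \<epsilon>) \<cdot> l)"
      unfolding left_antipode_iff_left_codivision[OF \<mu> \<delta> lam_Hom[OF l]] eq[symmetric] by (rule l)
    then show "left_Hopf_coquasigroup C H \<eta> \<mu> \<epsilon> \<delta>"
      using assms(2) by (auto simp: left_Hopf_coquasigroup_def)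
  next
    assume "left_Hopf_coquasigroup C H \<eta> \<mu> \<epsilon> \<delta>"
    then obtain lam where lam: "left_antipode C H \<eta> \<mu> \<delta> lam"
      by (auto simp: left_Hopf_coquasigroup_def)
    then have lH: "lam \<in> Hom C H H" by (simp add: left_antipode_def)
    have "left_codivision C H \<eta> \<mu> \<delta> ((lam \<triangleleft> H) \<cdot> \<delta>)"
      using lam left_antipode_iff_left_codivision[OF \<mu> \<delta> lH] by simp
    then show "\<exists>l. left_codivision C H \<eta> \<mu> \<delta> l \<and> l = (((H \<triangleright> \<epsilon>) \<cdot> l) \<triangleleft> H) \<cdot> \<delta>"
      using counit_recovers_antipode[OF com lH] by metis
  qed
  show ?thesis
    unfolding Let_def i_iii[symmetric] using i_ii by blast
qed

end
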